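(* For every integer $n\ge1$ define $$C_n^H=\int_0^\infty\frac1t e^{-t}f_1(i,t)\left[-1+{}_4F_3\!\left(\tfrac14-n,\tfrac12-n,\tfrac34-n,-n;\tfrac14,\tfrac12,\tfrac34;\frac{t^4}{\tilde\omega^4}\right)\right]dt.$$ Then $$\frac{4^{2n-1}}{8n}\tilde H_{4n}=C_n^H-\sum_{k=1}^{n-1}\binom{4n}{4k}\frac{4^{2k-1}}{8k}\tilde H_{4k}.$$
   Context: Let $\tilde\omega=2\int_0^1\frac{dx}{\sqrt{1-x^4}}=\frac{\sqrt\pi}{2}\frac{\Gamma(1/4)}{\Gamma(3/4)}$, and let $\wp$ be the Weierstrass elliptic function with period lattice $\tilde\omega\mathbb Z+\tilde\omega i\mathbb Z$. The Hurwitz numbers $\tilde H_n$ ($n\ge2$) are defined by the Laurent expansion $\wp(z)=\frac1{z^2}+\sum_{n\ge2}\frac{2^n\tilde H_n}{n}\frac{z^{n-2}}{(n-2)!}$ about $z=0$. Here $f_1(i,t)=\dfrac{\cos^2(t/2)}{1-2e^{-t}\cos t+e^{-2t}}$, and ${}_4F_3(a_1,\dots,a_4;b_1,b_2,b_3;x)=\sum_{k\ge0}\frac{(a_1)_k\cdots(a_4)_k}{(b_1)_k(b_2)_k(b_3)_k}\frac{x^k}{k!}$ with $(a)_k$ the Pochhammer symbol (the series here terminates). *)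

theory Defs
  imports "HOL-Analysis.Analysis"
begin

text \<open>The real constant omega-tilde = 2 * int_0^1 dx/sqrt(1-x^4) = sqrt(pi)/2 * Gamma(1/4)/Gamma(3/4).\<close>
definition omega_t :: real where
  "omega_t = sqrt pi / 2 * Gamma (1/4) / Gamma (3/4)"

definition lattice :: "complex set" where
  "lattice = {of_int a * complex_of_real omega_t + of_int b * complex_of_real omega_t * \<i> | a b. True}"

text \<open>Regular part of the Weierstrass function: wp z - 1/z^2 (extended holomorphically to z = 0).\<close>
definition wp_reg :: "complex \<Rightarrow> complex" where
  "wp_reg z = (\<Sum>\<^sub>\<infinity>w\<in>lattice - {0}. 1 / (z - w)^2 - 1 / w^2)"

definition wp :: "complex \<Rightarrow> complex" where
  "wp z = 1 / z^2 + wp_reg z"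

text \<open>Hurwitz numbers: wp z = 1/z^2 + sum_{n>=2} 2^n H_n / n * z^(n-2)/(n-2)!, i.e.
  2^n H_n / n is the (n-2)-th derivative at 0 of the regular part wp z - 1/z^2.\<close>
definition hurwitz :: "nat \<Rightarrow> complex" where
  "hurwitz n = of_nat n / 2 ^ n * (deriv ^^ (n - 2)) wp_reg 0"

definition f1 :: "real \<Rightarrow> real" where
  "f1 t = (cos (t/2))^2 / (1 - 2 * exp (-t) * cos t + exp (-2*t))"

definition hyp4F3 :: "real \<Rightarrow> real \<Rightarrow> real \<Rightarrow> real \<Rightarrow> real \<Rightarrow> real \<Rightarrow> real \<Rightarrow> real \<Rightarrow> real" where
  "hyp4F3 a1 a2 a3 a4 b1 b2 b3 x =
     (\<Sum>k. pochhammer a1 k * pochhammer a2 k * pochhammer a3 k * pochhammer a4 k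
           / (pochhammer b1 k * pochhammer b2 k * pochhammer b3 k) * x ^ k / fact k)"

definition C_H :: "nat \<Rightarrow> real" where
  "C_H n = (LBINT t:{0<..}. 1 / t * exp (-t) * f1 t *
      (-1 + hyp4F3 (1/4 - real n) (1/2 - real n) (3/4 - real n) (- real n) (1/4) (1/2) (3/4)
              (t ^ 4 / omega_t ^ 4)))"

end

theory Submission
  imports Defs "HOL-Real_Asymp.Real_Asymp"
begin

text \<open>
  The terminating hypergeometric series is $\sum_{k\le n}\binom{4n}{4k}x^k$, and the Laurent
  coefficients of $\wp$ are Eisenstein sums, so everything reduces to
  $\int_0^\infty t^{s-1}e^{-t}f_1(t)\,dt = \frac{(s-1)!}{8}\sum_{w\in\mathbb{Z}[i]\setminus 0}w^{-s}$
  for $4\mid s$. Multiplication by $i$ reduces the Eisenstein sum to four times the sum over the sector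
  $-a<b\le a$, $a>0$ of Gaussian integers $a+bi$. There $(s-1)!\,w^{-s}$ is the Laplace transform of
  $t^{s-1}$, and summing $\mathrm{Re}\,e^{-wt}$ over the sector gives exactly $2e^{-t}f_1(t)$.
\<close>

subsection \<open>The hypergeometric polynomial\<close>

text \<open>The Laplace transform needs Re w > 0, and e^(-at) must control a whole column of points
  a+bi. A quadrant would also represent every orbit of multiplication by i, but its columns are
  infinite and the sum of cos(bt) over them diverges; the sector has just 2a points in column a.
  Near 0 the denominator of \<open>f1\<close> is |1 - e^(-(1+i)t)|^2, of order t^2, so only t^m with
  m >= 2 tames it. The -1 in the integrand deletes the constant term of the polynomial; what is left
  after division by t has exponents 4k-1 >= 3, so every Eisenstein sum that occurs converges
  absolutely. Taking real parts loses nothing, because conjugation symmetry makes the Eisenstein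
  sums real. The recurrence needs no inversion: \<open>C_H n\<close> is one binomial sum over k =
  1..n, whose last term is moved to the other side.\<close>

lemma pochhammer_quadruple:
  fixes z :: "'a::field_char_0"
  shows "pochhammer (4 * z) (4 * k) =
    4 ^ (4 * k) * (pochhammer z k * pochhammer (z + 1/4) k * pochhammer (z + 1/2) k * pochhammer (z + 3/4) k)"
proof -
  \<comment> \<open>The duplication formula is applied to 4z, and then to each of its two factors 2z
    and 2z + 1/2 = 2(z + 1/4).\<close>
  have "pochhammer (2 * (2 * z)) (2 * (2 * k)) =
      of_nat (2 ^ (2 * (2 * k))) * pochhammer (2 * z) (2 * k) * pochhammer (2 * z + 1/2) (2 * k)"
    by (rule pochhammer_double)
  also have "2 * z + 1/2 = 2 * (z + 1/4)"
    by (simp add: field_simps)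
  also have "pochhammer (2 * (z + 1/4)) (2 * k) =
      of_nat (2 ^ (2 * k)) * pochhammer (z + 1/4) k * pochhammer (z + 1/4 + 1/2) k"
    by (rule pochhammer_double)
  also have "z + 1/4 + 1/2 = z + 3/4"
    by (simp add: add.assoc)
  also have "pochhammer (2 * z) (2 * k) = of_nat (2 ^ (2 * k)) * pochhammer z k * pochhammer (z + 1/2) k"
    by (rule pochhammer_double)
  also have "(4::'a) ^ (4 * k) = 2 ^ (2 * (2 * k)) * 2 ^ (2 * k) * 2 ^ (2 * k)"
    by (simp add: power_mult flip: power_mult_distrib)
  ultimately show ?thesis
    by (simp add: mult_ac)
qed

text \<open>The upper parameters are the quarter shifts of z = -n. The lower ones are those of z =
  1/4, the missing shift 1 being supplied by \<open>fact k\<close>. Both products therefore collapse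
  by \<open>pochhammer_quadruple\<close>, and the powers of 4 cancel.\<close>

lemma hyp4F3_eq_sum_binomial:
  "hyp4F3 (1/4 - real n) (1/2 - real n) (3/4 - real n) (- real n) (1/4) (1/2) (3/4) x =
     (\<Sum>k\<le>n. real ((4 * n) choose (4 * k)) * x ^ k)"
proof -
  have "pochhammer (1/4 - real n) k * pochhammer (1/2 - real n) k * pochhammer (3/4 - real n) k
          * pochhammer (- real n) k
        / (pochhammer (1/4) k * pochhammer (1/2) k * pochhammer (3/4) k) * x ^ k / fact k
      = real ((4 * n) choose (4 * k)) * x ^ k" for k
  proof -
    \<comment> \<open>The sign (-1)^(4k) of the generalized binomial is 1, and (4k)! is the
      Pochhammer symbol of 1 = 4 * (1/4).\<close>
    have "real ((4 * n) choose (4 * k)) = pochhammer (4 * (- real n)) (4 * k) / pochhammer (4 * (1/4)) (4 * k)"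
      by (simp add: binomial_gbinomial gbinomial_pochhammer pochhammer_fact)
    also have "\<dots> = pochhammer (1/4 - real n) k * pochhammer (1/2 - real n) k * pochhammer (3/4 - real n) k
          * pochhammer (- real n) k
        / (pochhammer (1/4) k * pochhammer (1/2) k * pochhammer (3/4) k * fact k)"
      unfolding pochhammer_quadruple by (simp add: mult_ac pochhammer_fact)
    finally show ?thesis
      by simp
  qed
  hence "hyp4F3 (1/4 - real n) (1/2 - real n) (3/4 - real n) (- real n) (1/4) (1/2) (3/4) x =
      (\<Sum>k. real ((4 * n) choose (4 * k)) * x ^ k)"
    by (simp add: hyp4F3_def)
  also have "\<dots> = (\<Sum>k\<le>n. real ((4 * n) choose (4 * k)) * x ^ k)"
    by (rule suminf_finite) (auto simp: binomial_eq_0)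
  finally show ?thesis .
qed

subsection \<open>Laplace transforms\<close>

text \<open>The antiderivative is normalised to vanish at infinity, so that -F(0) is the Laplace
  transform. Induction on m replaces an explicit incomplete-gamma polynomial.\<close>

lemma antiderivative_power_exp:
  fixes w :: complex
  assumes "Re w > 0"
  obtains F :: "real \<Rightarrow> complex" where
    "\<And>t. (F has_vector_derivative of_real t ^ m * exp (- w * of_real t)) (at t)"
    "F 0 = - fact m / w ^ Suc m" "(F \<longlongrightarrow> 0) at_top"
proof -
  have w: "w \<noteq> 0"
    using assms by auto
  have lim: "((\<lambda>t::real. of_real t ^ m * exp (- w * of_real t)) \<longlongrightarrow> 0) at_top" for m
  proof (rule tendsto_norm_zero_cancel)
    have "((\<lambda>t::real. t ^ m * exp (- Re w * t)) \<longlongrightarrow> 0) at_top"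
      using assms by real_asymp
    thus "((\<lambda>t::real. norm (of_real t ^ m * exp (- w * of_real t))) \<longlongrightarrow> 0) at_top"
      by (rule Lim_transform_eventually)
         (use eventually_ge_at_top[of 0] in eventually_elim, simp add: norm_mult norm_power)
  qed
  have der: "((\<lambda>t::real. of_real t ^ m * exp (- w * of_real t)) has_vector_derivative
      (of_nat m * of_real t ^ (m - 1) - w * of_real t ^ m) * exp (- w * of_real t)) (at t)" for m t
  proof -
    have "((\<lambda>z. z ^ m * exp (- w * z)) has_field_derivative
        (of_nat m * of_real t ^ (m - 1) - w * of_real t ^ m) * exp (- w * of_real t)) (at (of_real t))"
      by (auto intro!: derivative_eq_intros simp: algebra_simps)
    from has_vector_derivative_real_field[OF this] show ?thesis .
  qed
  have "\<exists>F :: real \<Rightarrow> complex.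
    (\<forall>t. (F has_vector_derivative of_real t ^ m * exp (- w * of_real t)) (at t)) \<and>
    F 0 = - fact m / w ^ Suc m \<and> (F \<longlongrightarrow> 0) at_top"
  proof (induction m)
    case 0
    have "((\<lambda>t::real. exp (- w * of_real t) / (-w)) has_vector_derivative exp (- w * of_real t)) (at t)" for t
      using has_vector_derivative_divide[OF der[of 0 t], of "-w"] w by simp
    moreover have "((\<lambda>t::real. exp (- w * of_real t) / (-w)) \<longlongrightarrow> 0) at_top"
      using tendsto_divide[OF lim[of 0] tendsto_const[of "-w"]] w by simp
    ultimately show ?case
      by (intro exI[of _ "\<lambda>t::real. exp (- w * of_real t) / (-w)"]) auto
  next
    case (Suc m)
    then obtain F :: "real \<Rightarrow> complex" where F:
      "\<And>t. (F has_vector_derivative of_real t ^ m * exp (- w * of_real t)) (at t)"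
      "F 0 = - fact m / w ^ Suc m" "(F \<longlongrightarrow> 0) at_top"
      by blast
    \<comment> \<open>Integration by parts: the derivative of t^(m+1) e^(-wt) is (m+1) t^m e^(-wt) -
      w t^(m+1) e^(-wt).\<close>
    let ?G = "\<lambda>t::real. (of_nat (Suc m) * F t - of_real t ^ Suc m * exp (- w * of_real t)) / w"
    have "(?G has_vector_derivative of_real t ^ Suc m * exp (- w * of_real t)) (at t)" for t
    proof -
      have "(?G has_vector_derivative (of_nat (Suc m) * (of_real t ^ m * exp (- w * of_real t)) -
          (of_nat (Suc m) * of_real t ^ (Suc m - 1) - w * of_real t ^ Suc m) * exp (- w * of_real t)) / w) (at t)"
        by (intro has_vector_derivative_divide has_vector_derivative_diff
              has_vector_derivative_mult_right F der)
      thus ?thesis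
        using w by (simp add: algebra_simps)
    qed
    moreover have "?G 0 = - fact (Suc m) / w ^ Suc (Suc m)"
      unfolding F(2) using w by (simp add: field_simps)
    moreover have "(?G \<longlongrightarrow> (of_nat (Suc m) * 0 - 0) / w) at_top"
      using w by (intro tendsto_intros F lim) auto
    ultimately show ?case
      by (intro exI[of _ ?G]) auto
  qed
  thus ?thesis
    using that by blast
qed

lemma
  fixes w :: complex
  assumes "Re w > 0"
  shows set_integrable_power_exp:
      "set_integrable lborel {0<..} (\<lambda>t. of_real t ^ m * exp (- w * of_real t))"
    and LBINT_power_exp:
      "(LBINT t:{0<..}. of_real t ^ m * exp (- w * of_real t)) = fact m / w ^ Suc m"
proof -
  have eint: "einterval 0 \<infinity> = {0<..}"
    by (auto simp: einterval_def zero_ereal_def)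
  have limits: "((F \<circ> real_of_ereal) \<longlongrightarrow> F 0) (at_right 0)" "((F \<circ> real_of_ereal) \<longlongrightarrow> 0) (at_left \<infinity>)"
    if "\<And>t. isCont F t" "(F \<longlongrightarrow> 0) at_top" for F :: "real \<Rightarrow> 'b::real_normed_vector"
  proof -
    have "(F \<longlongrightarrow> F 0) (at_right 0)"
      using that(1)[of 0] by (simp add: isCont_def filterlim_at_split)
    thus "((F \<circ> real_of_ereal) \<longlongrightarrow> F 0) (at_right 0)"
      unfolding zero_ereal_def by (simp add: ereal_tendsto_simps)
    show "((F \<circ> real_of_ereal) \<longlongrightarrow> 0) (at_left \<infinity>)"
      using that(2) by (simp add: ereal_tendsto_simps)
  qed
  \<comment> \<open>On t > 0 this is the norm of the complex integrand. Being nonnegative, it gets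
    its integrability from the fundamental theorem itself, and then dominates the complex
    one.\<close>
  have real: "set_integrable lborel {0<..} (\<lambda>t. t ^ m * exp (- Re w * t))"
  proof -
    obtain F :: "real \<Rightarrow> complex" where F:
      "\<And>t. (F has_vector_derivative of_real t ^ m * exp (- of_real (Re w) * of_real t)) (at t)"
      "F 0 = - fact m / of_real (Re w) ^ Suc m" "(F \<longlongrightarrow> 0) at_top"
      using antiderivative_power_exp[of "of_real (Re w)" m] assms by auto
    have D: "((\<lambda>t. Re (F t)) has_real_derivative t ^ m * exp (- Re w * t)) (at t)" for t
    proof -
      have "((\<lambda>t. Re (F t)) has_vector_derivative Re (of_real t ^ m * exp (- of_real (Re w) * of_real t))) (at t)"
        using F(1) by (rule bounded_linear.has_vector_derivative[OF bounded_linear_Re])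
      also have "of_real t ^ m * exp (- of_real (Re w) * of_real t) = complex_of_real (t ^ m * exp (- Re w * t))"
        by (simp add: exp_of_real[symmetric] del: exp_of_real)
      finally show ?thesis
        by (simp only: has_real_derivative_iff_has_vector_derivative Re_complex_of_real)
    qed
    have "((\<lambda>t. Re (F t)) \<longlongrightarrow> 0) at_top"
      using tendsto_Re[OF F(3)] by simp
    with D have "set_integrable lborel (einterval 0 \<infinity>) (\<lambda>t. t ^ m * exp (- Re w * t))"
      by (intro interval_integral_FTC_nonneg(1)[of _ _ "\<lambda>t. Re (F t)" _ "Re (F 0)" 0] limits AE_I2)
         (auto intro!: DERIV_isCont continuous_intros simp: zero_ereal_def)
    thus ?thesis
      by (simp add: eint)
  qed
  show int: "set_integrable lborel {0<..} (\<lambda>t. of_real t ^ m * exp (- w * of_real t))"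
  proof (rule set_integrable_bound[OF real])
    show "set_borel_measurable lborel {0<..} (\<lambda>t. of_real t ^ m * exp (- w * of_real t))"
      unfolding set_borel_measurable_def by measurable
  qed (auto simp: norm_mult norm_power)
  obtain F :: "real \<Rightarrow> complex" where F:
      "\<And>t. (F has_vector_derivative of_real t ^ m * exp (- w * of_real t)) (at t)"
      "F 0 = - fact m / w ^ Suc m" "(F \<longlongrightarrow> 0) at_top"
    using antiderivative_power_exp[of w m] assms by auto
  have "(LBINT t=0..\<infinity>. of_real t ^ m * exp (- w * of_real t)) = 0 - F 0"
  proof (rule interval_integral_FTC_integrable[where F = F])
    show "((F \<circ> real_of_ereal) \<longlongrightarrow> F 0) (at_right 0)" "((F \<circ> real_of_ereal) \<longlongrightarrow> 0) (at_left \<infinity>)"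
      by (rule limits has_vector_derivative_continuous F)+
  qed (use int F(1) in \<open>auto simp: eint intro!: continuous_intros\<close>)
  thus "(LBINT t:{0<..}. of_real t ^ m * exp (- w * of_real t)) = fact m / w ^ Suc m"
    by (simp add: interval_lebesgue_integral_def eint F(2))
qed

subsection \<open>The integrand as a sum over the sector\<close>

text \<open>The real part of the sum of $e^{-ibt}$ over the column of the sector with real part $k$. The
  next column adds only $b = -k$ and $b = k+1$, which yields a three-term recurrence with constant
  coefficients and hence a rational generating function in $e^{-t}$.\<close>
definition dirichlet_sum :: "nat \<Rightarrow> real \<Rightarrow> real" where
  "dirichlet_sum k t = (\<Sum>b\<in>{- int k<..int k}. cos (of_int b * t))"

lemma dirichlet_sum_0 [simp]: "dirichlet_sum 0 t = 0"
  by (simp add: dirichlet_sum_def)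

lemma dirichlet_sum_Suc: "dirichlet_sum (Suc k) t = dirichlet_sum k t + cos (real k * t) + cos (real (Suc k) * t)"
proof -
  have "{- int (Suc k)<..int (Suc k)} = insert (- int k) (insert (int (Suc k)) {- int k<..int k})"
    by auto
  thus ?thesis
    by (simp add: dirichlet_sum_def)
qed

text \<open>The increments are sums of two consecutive cos(kt), and these obey the same Chebyshev
  recurrence. Induction thus leaves only the base case, which is cos 2t = 2 cos^2 t - 1.\<close>

lemma dirichlet_sum_recurrence:
  "dirichlet_sum (Suc (Suc k)) t = 2 * cos t * dirichlet_sum (Suc k) t - dirichlet_sum k t"
proof (induction k)
  case 0
  show ?case
    using cos_double_cos[of t] by (simp add: dirichlet_sum_Suc algebra_simps power2_eq_square)
next
  case (Suc k)
  have *: "cos (real (Suc (Suc j)) * t) = 2 * cos t * cos (real (Suc j) * t) - cos (real j * t)" for j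
    using cos_add[of "real (Suc j) * t" t] cos_diff[of "real (Suc j) * t" t] by (simp add: algebra_simps)
  show ?case
    using Suc unfolding dirichlet_sum_Suc[of "Suc (Suc k)"] dirichlet_sum_Suc[of "Suc k"] dirichlet_sum_Suc[of k]
       *[of "Suc k"] *[of k] by (simp add: algebra_simps)
qed

lemma abs_dirichlet_sum_le: "\<bar>dirichlet_sum k t\<bar> \<le> 2 * real k"
proof -
  have "\<bar>dirichlet_sum k t\<bar> \<le> (\<Sum>b\<in>{- int k<..int k}. \<bar>cos (of_int b * t)\<bar>)"
    unfolding dirichlet_sum_def by (rule sum_abs)
  also have "\<dots> \<le> (\<Sum>b\<in>{- int k<..int k}. 1)"
    by (intro sum_mono) auto
  finally show ?thesis
    by simp
qed

lemma
  fixes x :: real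
  assumes "\<bar>x\<bar> < 1"
  shows summable_dirichlet_sum: "summable (\<lambda>k. \<bar>dirichlet_sum k t * x ^ k\<bar>)"
    and suminf_dirichlet_sum:
      "(\<Sum>k. dirichlet_sum k t * x ^ k) = x * (1 + cos t) / (1 - 2 * x * cos t + x ^ 2)"
proof -
  have "summable (\<lambda>k. 2 * (real (Suc k) * \<bar>x\<bar> ^ k))"
    by (intro summable_mult sums_summable[OF geometric_deriv_sums]) (use assms in auto)
  show sm: "summable (\<lambda>k. \<bar>dirichlet_sum k t * x ^ k\<bar>)"
  proof (rule summable_comparison_test'[where N = 0])
    show "norm \<bar>dirichlet_sum k t * x ^ k\<bar> \<le> 2 * (real (Suc k) * \<bar>x\<bar> ^ k)" for k
    proof -
      have "\<bar>dirichlet_sum k t\<bar> * \<bar>x\<bar> ^ k \<le> (2 * real (Suc k)) * \<bar>x\<bar> ^ k"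
        using abs_dirichlet_sum_le[of k t] by (intro mult_right_mono) auto
      thus ?thesis
        by (simp add: abs_mult power_abs mult.assoc del: of_nat_Suc)
    qed
  qed fact
  hence sm': "summable (\<lambda>k. dirichlet_sum k t * x ^ k)"
    by (rule summable_rabs_cancel)
  define S where "S = (\<Sum>k. dirichlet_sum k t * x ^ k)"
  have 0: "(\<lambda>k. dirichlet_sum k t * x ^ k) sums S"
    using sm' by (simp add: S_def summable_sums)
  have 1: "(\<lambda>k. dirichlet_sum (Suc k) t * x ^ Suc k) sums S"
    using 0 by (subst sums_Suc_iff) simp
  \<comment> \<open>Shifting twice drops the vanishing k = 0 term and the k = 1 term x(1 + cos t),
    which becomes the numerator.\<close>
  have 2: "(\<lambda>k. dirichlet_sum (Suc (Suc k)) t * x ^ Suc (Suc k)) sums (S - x * (1 + cos t))"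
    using 1 by (subst sums_Suc_iff) (simp add: dirichlet_sum_Suc mult.commute)
  have "(\<lambda>k. 2 * x * cos t * (dirichlet_sum (Suc k) t * x ^ Suc k) - x ^ 2 * (dirichlet_sum k t * x ^ k))
      sums (2 * x * cos t * S - x ^ 2 * S)"
    by (intro sums_diff sums_mult 0 1)
  also have "(\<lambda>k. 2 * x * cos t * (dirichlet_sum (Suc k) t * x ^ Suc k) - x ^ 2 * (dirichlet_sum k t * x ^ k)) =
      (\<lambda>k. dirichlet_sum (Suc (Suc k)) t * x ^ Suc (Suc k))"
    by (simp add: dirichlet_sum_recurrence algebra_simps power2_eq_square)
  finally have "S - x * (1 + cos t) = 2 * x * cos t * S - x ^ 2 * S"
    using 2 sums_unique2 by blast
  hence "S * (1 - 2 * x * cos t + x ^ 2) = x * (1 + cos t)"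
    by (simp add: algebra_simps)
  \<comment> \<open>The denominator is at least (1 - |x|)^2, so solving for S is legitimate.\<close>
  moreover have "1 - 2 * x * cos t + x ^ 2 > 0"
  proof -
    have "0 < (1 - \<bar>x\<bar>) ^ 2"
      using assms by auto
    also have "\<dots> = 1 - 2 * \<bar>x\<bar> + x ^ 2"
      by (simp add: power2_diff)
    also have "x * cos t \<le> \<bar>x\<bar>"
      by (metis abs_cos_le_one abs_le_D1 abs_mult mult_left_le abs_ge_zero)
    hence "1 - 2 * \<bar>x\<bar> + x ^ 2 \<le> 1 - 2 * x * cos t + x ^ 2"
      by simp
    finally show ?thesis .
  qed
  ultimately show "(\<Sum>k. dirichlet_sum k t * x ^ k) = x * (1 + cos t) / (1 - 2 * x * cos t + x ^ 2)"
    by (simp add: S_def field_simps)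
qed

lemma
  fixes a b :: real
  assumes "a > 0"
  shows set_integrable_power_exp_cos:
      "set_integrable lborel {0<..} (\<lambda>t. t ^ m * exp (- a * t) * cos (b * t))"
    and LBINT_power_exp_cos:
      "(LBINT t:{0<..}. t ^ m * exp (- a * t) * cos (b * t)) = fact m * Re (1 / Complex a b ^ Suc m)"
proof -
  have *: "indicator {0<..} t *\<^sub>R (t ^ m * exp (- a * t) * cos (b * t)) =
      Re (indicator {0<..} t *\<^sub>R (of_real t ^ m * exp (- Complex a b * of_real t)))" for t :: real
  proof -
    have "Re (of_real t ^ m * exp (- Complex a b * of_real t)) = t ^ m * Re (exp (- Complex a b * of_real t))"
      by (simp flip: of_real_power)
    thus ?thesis
      by (simp add: Re_exp)
  qed
  have int: "set_integrable lborel {0<..} (\<lambda>t. of_real t ^ m * exp (- Complex a b * of_real t))"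
    using assms by (intro set_integrable_power_exp) auto
  thus "set_integrable lborel {0<..} (\<lambda>t. t ^ m * exp (- a * t) * cos (b * t))"
    unfolding set_integrable_def * by (rule integrable_Re)
  have "(LBINT t:{0<..}. t ^ m * exp (- a * t) * cos (b * t)) =
      Re (LBINT t:{0<..}. of_real t ^ m * exp (- Complex a b * of_real t))"
    unfolding set_lebesgue_integral_def * by (rule integral_Re) (use int in \<open>simp add: set_integrable_def\<close>)
  also have "\<dots> = Re (of_real (fact m) * (1 / Complex a b ^ Suc m))"
    using assms by (subst LBINT_power_exp) auto
  also have "\<dots> = fact m * Re (1 / Complex a b ^ Suc m)"
    by (simp only: times_complex.sel Re_complex_of_real Im_complex_of_real)
  finally show "(LBINT t:{0<..}. t ^ m * exp (- a * t) * cos (b * t)) = fact m * Re (1 / Complex a b ^ Suc m)" .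
qed

lemma f1_eq_suminf:
  assumes "t > 0"
  shows "(\<Sum>k. dirichlet_sum k t * exp (- real k * t)) = 2 * exp (- t) * f1 t"
proof -
  have "(\<Sum>k. dirichlet_sum k t * exp (- t) ^ k) =
      exp (- t) * (1 + cos t) / (1 - 2 * exp (- t) * cos t + exp (- t) ^ 2)"
    using assms by (intro suminf_dirichlet_sum) auto
  \<comment> \<open>The half-angle formula yields the numerator of \<open>f1\<close> and the extra
    factor 2.\<close>
  also have "1 + cos t = 2 * cos (t / 2) ^ 2"
    using cos_double_cos[of "t / 2"] by simp
  also have "exp (- t) ^ 2 = exp (- 2 * t)"
    by (simp flip: exp_of_nat_mult)
  finally show ?thesis
    by (simp add: f1_def flip: exp_of_nat_mult)
qed

text \<open>Series and integral are interchanged by summability of the L1 norms. Column k has 2k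
  points, each bounded by t^m e^(-kt), so its norm is at most 2k m!/k^(m+1) = 2 m!/k^m; this is
  summable for m >= 2 without using any cancellation.\<close>

lemma
  assumes "m \<ge> 2"
  shows set_integrable_power_f1: "set_integrable lborel {0<..} (\<lambda>t. t ^ m * (exp (- t) * f1 t))"
    and sums_LBINT_power_f1:
      "(\<lambda>k. \<Sum>b\<in>{- int k<..int k}. Re (1 / Complex (real k) (of_int b) ^ Suc m)) sums
        (2 / fact m * (LBINT t:{0<..}. t ^ m * (exp (- t) * f1 t)))"
proof -
  define g where "g = (\<lambda>k t. indicator {0<..} t *\<^sub>R (t ^ m * (dirichlet_sum k t * exp (- real k * t))))"
  have g_eq: "g k t = (\<Sum>b\<in>{- int k<..int k}. indicator {0<..} t *\<^sub>R (t ^ m * exp (- real k * t) * cos (of_int b * t)))"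
    for k t
    by (simp add: g_def dirichlet_sum_def sum_distrib_left sum_distrib_right mult_ac)
  have int: "integrable lborel (\<lambda>t. indicator {0<..} t *\<^sub>R (t ^ m * exp (- real k * t) * cos (of_int b * t)))"
    if "b \<in> {- int k<..int k}" for k b
    using set_integrable_power_exp_cos[of "real k" m "of_int b"] that
    by (simp add: set_integrable_def)
  have g_int: "integrable lborel (g k)" for k
    unfolding g_eq[abs_def] using int by (intro Bochner_Integration.integrable_sum) auto
  have g_integral: "integral\<^sup>L lborel (g k) =
      fact m * (\<Sum>b\<in>{- int k<..int k}. Re (1 / Complex (real k) (of_int b) ^ Suc m))" for k
  proof -
    have "integral\<^sup>L lborel (g k) = (\<Sum>b\<in>{- int k<..int k}.
        LBINT t:{0<..}. t ^ m * exp (- real k * t) * cos (of_int b * t))"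
      unfolding g_eq[abs_def] set_lebesgue_integral_def using int by (intro Bochner_Integration.integral_sum) auto
    also have "\<dots> = (\<Sum>b\<in>{- int k<..int k}. fact m * Re (1 / Complex (real k) (of_int b) ^ Suc m))"
      by (intro sum.cong refl LBINT_power_exp_cos) auto
    finally show ?thesis
      by (simp only: sum_distrib_left)
  qed
  have g_abs_summable: "summable (\<lambda>k. norm (g k t))" for t
  proof (cases "t > 0")
    case True
    have "summable (\<lambda>k. \<bar>t\<bar> ^ m * \<bar>dirichlet_sum k t * exp (- t) ^ k\<bar>)"
      using True by (intro summable_mult summable_dirichlet_sum) auto
    thus ?thesis
      using True by (simp add: g_def abs_mult power_abs flip: exp_of_nat_mult)
  qed (simp add: g_def)
  have g_le: "(\<integral>t. norm (g k t) \<partial>lborel) \<le> 2 * fact m * (1 / real k ^ 2)" for k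
  \<comment> \<open>Column 0 is empty and 1/0 = 0, so the bound reads 0 <= 0 there.\<close>
  proof (cases "k = 0")
    case False
    \<comment> \<open>Taking b = 0 makes the cosine 1, so the dominating function belongs to the
      family already integrated.\<close>
    have i0: "integrable lborel (\<lambda>t. indicator {0<..} t *\<^sub>R (t ^ m * exp (- real k * t) * cos (of_int 0 * t)))"
      using False by (intro int) auto
    have "(\<integral>t. norm (g k t) \<partial>lborel) \<le>
        (\<integral>t. 2 * real k * (indicator {0<..} t *\<^sub>R (t ^ m * exp (- real k * t) * cos (of_int 0 * t))) \<partial>lborel)"
    proof (rule integral_mono)
      fix t :: real
      have "\<bar>dirichlet_sum k t\<bar> * (t ^ m * exp (- real k * t)) \<le> 2 * real k * (t ^ m * exp (- real k * t))" if "t > 0"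
        using that by (intro mult_right_mono abs_dirichlet_sum_le) auto
      moreover have "norm (g k t) = indicator {0<..} t * (\<bar>dirichlet_sum k t\<bar> * (t ^ m * exp (- real k * t)))"
        by (simp add: g_def abs_mult indicator_def)
      ultimately show "norm (g k t) \<le> 2 * real k * (indicator {0<..} t *\<^sub>R (t ^ m * exp (- real k * t) * cos (of_int 0 * t)))"
        by (simp add: indicator_def)
    qed (use g_int i0 in auto)
    also have "\<dots> = 2 * real k * (fact m * Re (1 / Complex (real k) 0 ^ Suc m))"
      using LBINT_power_exp_cos[of "real k" m 0] False
      by (simp add: set_lebesgue_integral_def)
    also have "1 / Complex (real k) 0 ^ Suc m = complex_of_real (1 / real k ^ Suc m)"
      by (simp flip: complex_of_real_def)
    also have "Re (complex_of_real (1 / real k ^ Suc m)) = 1 / real k ^ Suc m"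
      by (rule Re_complex_of_real)
    also have "2 * real k * (fact m * (1 / real k ^ Suc m)) = 2 * fact m * (1 / real k ^ m)"
      using False by simp
    also have "\<dots> \<le> 2 * fact m * (1 / real k ^ 2)"
      using False assms by (intro mult_left_mono divide_left_mono power_increasing) auto
    finally show ?thesis .
  qed (simp add: g_def)
  have g_norm_summable: "summable (\<lambda>k. \<integral>t. norm (g k t) \<partial>lborel)"
  proof (rule summable_comparison_test'[where N = 0])
    show "summable (\<lambda>k. 2 * fact m * (1 / real k ^ 2))"
      using inverse_power_summable[of 2, where ?'a = real] by (intro summable_mult) (simp add: field_simps)
  qed (use g_le in simp)
  have suminf_g: "(\<Sum>k. g k t) = 2 * (indicator {0<..} t *\<^sub>R (t ^ m * (exp (- t) * f1 t)))" for t
  proof (cases "t > 0")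
    case True
    have "summable (\<lambda>k. dirichlet_sum k t * exp (- t) ^ k)"
      using True by (intro summable_rabs_cancel[OF summable_dirichlet_sum]) auto
    hence "(\<Sum>k. t ^ m * (dirichlet_sum k t * exp (- real k * t))) = t ^ m * (2 * exp (- t) * f1 t)"
      using True by (subst suminf_mult) (simp_all add: f1_eq_suminf[symmetric] flip: exp_of_nat_mult)
    thus ?thesis
      using True by (simp add: g_def)
  qed (simp add: g_def)
  have "integrable lborel (\<lambda>t. 2 * (indicator {0<..} t *\<^sub>R (t ^ m * (exp (- t) * f1 t))))"
    using integrable_suminf[of lborel g] g_int g_abs_summable g_norm_summable
    unfolding suminf_g by auto
  thus "set_integrable lborel {0<..} (\<lambda>t. t ^ m * (exp (- t) * f1 t))"
    unfolding set_integrable_def by simp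
  have "(\<lambda>k. integral\<^sup>L lborel (g k)) sums (2 * (LBINT t:{0<..}. t ^ m * (exp (- t) * f1 t)))"
    using sums_integral[of lborel g] g_int g_abs_summable g_norm_summable
    unfolding suminf_g by (auto simp: set_lebesgue_integral_def)
  from sums_mult[OF this, of "1 / fact m"]
  show "(\<lambda>k. \<Sum>b\<in>{- int k<..int k}. Re (1 / Complex (real k) (of_int b) ^ Suc m)) sums
        (2 / fact m * (LBINT t:{0<..}. t ^ m * (exp (- t) * f1 t)))"
    unfolding g_integral by simp
qed

subsection \<open>Sums over the Gaussian integers\<close>

definition gauss_int :: "complex set" where
  "gauss_int = {w. Re w \<in> \<int> \<and> Im w \<in> \<int>}"

text \<open>A fundamental domain for multiplication by i on the nonzero Gaussian integers. Only the
  upper bounding diagonal is included, since i carries the lower one onto it.\<close>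

definition gauss_sector :: "complex set" where
  "gauss_sector = {w \<in> gauss_int. 0 < Re w \<and> - Re w < Im w \<and> Im w \<le> Re w}"

lemma gauss_sector_eq:
  "gauss_sector = (\<lambda>(k, b). Complex (real k) (of_int b)) ` (SIGMA k:UNIV. {- int k<..int k})"
proof (intro equalityI subsetI)
  fix w assume w: "w \<in> gauss_sector"
  then obtain a b where ab: "Re w = of_int a" "Im w = of_int b"
    by (auto simp: gauss_sector_def gauss_int_def Ints_def)
  hence "a > 0" "- a < b" "b \<le> a"
    using w by (simp_all add: gauss_sector_def)
  moreover from this ab have "w = Complex (real (nat a)) (of_int b)"
    by (simp add: complex_eq_iff)
  ultimately have *: "w = Complex (real (nat a)) (of_int b)" "- int (nat a) < b" "b \<le> int (nat a)"
    by auto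
  show "w \<in> (\<lambda>(k, b). Complex (real k) (of_int b)) ` (SIGMA k:UNIV. {- int k<..int k})"
    by (intro image_eqI[of _ _ "(nat a, b)"]) (simp only: prod.case *(1), use *(2,3) in simp)
qed (auto simp: gauss_sector_def gauss_int_def)

lemma has_sum_gauss_sector_iff:
  "(f has_sum S) gauss_sector \<longleftrightarrow>
     ((\<lambda>(k, b). f (Complex (real k) (of_int b))) has_sum S) (SIGMA k:UNIV. {- int k<..int k})"
proof -
  have "inj_on (\<lambda>(k, b). Complex (real k) (of_int b)) (SIGMA k:UNIV. {- int k<..int k})"
    by (auto simp: inj_on_def)
  thus ?thesis
    unfolding gauss_sector_eq by (simp add: has_sum_reindex o_def case_prod_unfold)
qed

lemma mem_times_i_image: "w \<in> (*) \<i> ` A \<longleftrightarrow> - \<i> * w \<in> A"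
  by (force intro: image_eqI[of _ _ "- \<i> * w"] simp flip: mult.assoc)

lemma mem_times_minus_image: "w \<in> (*) (-1) ` A \<longleftrightarrow> - w \<in> (A :: 'a::ring_1 set)"
  by (force intro: image_eqI[of _ _ "- w"])

lemma gauss_int_rotations:
  "gauss_int - {0} = (gauss_sector \<union> (*) \<i> ` gauss_sector) \<union>
     (*) (-1) ` (gauss_sector \<union> (*) \<i> ` gauss_sector)"
proof -
  \<comment> \<open>With w = x + iy, the four alternatives are the sector conditions for w, -iw, -w
    and iw.\<close>
  have real: "x \<noteq> 0 \<or> y \<noteq> 0 \<longleftrightarrow> 0 < x \<and> - x < y \<and> y \<le> x \<or> 0 < y \<and> x < y \<and> - x \<le> y \<or>
      x < 0 \<and> x < - y \<and> x \<le> y \<or> y < 0 \<and> y < x \<and> x \<le> - y" for x y :: real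
    by linarith
  have *: "w \<in> gauss_int - {0} \<longleftrightarrow> w \<in> gauss_sector \<or> - \<i> * w \<in> gauss_sector \<or>
      - w \<in> gauss_sector \<or> - \<i> * (- w) \<in> gauss_sector" for w
    using real[of "Re w" "Im w"]
    by (cases "Re w \<in> \<int> \<and> Im w \<in> \<int>")
       (simp add: gauss_sector_def gauss_int_def complex_eq_iff, auto simp: gauss_sector_def gauss_int_def)
  show ?thesis
    unfolding set_eq_iff Un_iff mem_times_i_image mem_times_minus_image by (simp only: * disj_assoc simp_thms)
qed

text \<open>Invariance under i gives invariance under -1, so the sum doubles twice: from the sector
  to a half-plane, then to everything. The general codomain serves both the norms and the complex
  powers.\<close>

lemma has_sum_gauss_int:
  fixes f :: "complex \<Rightarrow> 'a::{topological_ab_group_add, ring_1}"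
  assumes "(f has_sum S) gauss_sector" and rot: "\<And>w. f (\<i> * w) = f w"
  shows "(f has_sum (4 * S)) (gauss_int - {0})"
proof -
  have disj1: "gauss_sector \<inter> (*) \<i> ` gauss_sector = {}"
    and disj2: "(gauss_sector \<union> (*) \<i> ` gauss_sector) \<inter>
      (*) (-1) ` (gauss_sector \<union> (*) \<i> ` gauss_sector) = {}"
    unfolding disjoint_iff Un_iff mem_times_i_image mem_times_minus_image by (auto simp: gauss_sector_def)
  have neg: "f (- w) = f w" for w
    using rot[of "\<i> * w"] rot[of w] by simp
  have 1: "(f has_sum S) ((*) \<i> ` gauss_sector)"
    using assms by (subst has_sum_reindex) (auto simp: inj_on_def o_def)
  have 2: "(f has_sum (S + S)) (gauss_sector \<union> (*) \<i> ` gauss_sector)"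
    using assms(1) 1 disj1 by (rule has_sum_Un_disjoint)
  have 3: "(f has_sum (S + S)) ((*) (-1) ` (gauss_sector \<union> (*) \<i> ` gauss_sector))"
    using 2 by (subst has_sum_reindex) (auto simp: inj_on_def o_def neg)
  have "(f has_sum (S + S + (S + S))) (gauss_int - {0})"
    unfolding gauss_int_rotations using 2 3 disj2 by (rule has_sum_Un_disjoint)
  also have "S + S + (S + S) = 4 * S"
    by (simp only: mult_2[symmetric] distrib_left[symmetric] mult.assoc[symmetric]) simp
  finally show ?thesis .
qed

text \<open>Column k has 2k points of norm at least k, so it contributes at most 2k/k^3.\<close>

lemma abs_summable_gauss_sector:
  assumes "s \<ge> 3"
  shows "(\<lambda>w. 1 / norm w ^ s) summable_on gauss_sector"
proof -
  define g where "g = (\<lambda>k::nat. \<Sum>b\<in>{- int k<..int k}. 1 / norm (Complex (real k) (of_int b)) ^ s)"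
  have g_le: "g k \<le> 2 * (1 / real k ^ 2)" for k
  proof (cases "k = 0")
    case False
    have "g k \<le> (\<Sum>b\<in>{- int k<..int k}. 1 / real k ^ 3)"
      unfolding g_def
    proof (intro sum_mono divide_left_mono)
      fix b
      have "real k \<le> norm (Complex (real k) (of_int b))"
        using complex_Re_le_cmod[of "Complex (real k) (of_int b)"] by simp
      hence "real k ^ s \<le> norm (Complex (real k) (of_int b)) ^ s"
        by (intro power_mono) auto
      moreover have "real k ^ 3 \<le> real k ^ s"
        using False assms by (intro power_increasing) auto
      ultimately show "real k ^ 3 \<le> norm (Complex (real k) (of_int b)) ^ s"
        by linarith
      show "0 < norm (Complex (real k) (of_int b)) ^ s * real k ^ 3"
        using False by (auto simp: complex_eq_iff)
    qed auto
    also have "\<dots> = 2 * (1 / real k ^ 2)"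
      using False by (simp add: field_simps eval_nat_numeral)
    finally show ?thesis .
  qed (simp add: g_def)
  have "summable (\<lambda>k. 2 * (1 / real k ^ 2))"
    using inverse_power_summable[of 2, where ?'a = real] by (intro summable_mult) (simp add: field_simps)
  hence "summable g"
    by (rule summable_comparison_test'[where N = 0]) (use g_le in \<open>auto simp: g_def sum_nonneg\<close>)
  hence "g summable_on UNIV"
    by (rule summable_nonneg_imp_summable_on) (auto simp: g_def sum_nonneg)
  hence "(\<lambda>(k, b). 1 / norm (Complex (real k) (of_int b)) ^ s) summable_on (SIGMA k:UNIV. {- int k<..int k})"
    by (rule summable_on_SigmaI[rotated]) (auto simp: g_def intro!: has_sum_finiteI)
  thus ?thesis
    unfolding summable_on_def has_sum_gauss_sector_iff .
qed

lemma abs_summable_gauss_int: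
  assumes "s \<ge> 3"
  shows "(\<lambda>w. 1 / norm w ^ s) summable_on (gauss_int - {0})"
proof -
  obtain S where "((\<lambda>w. 1 / norm w ^ s) has_sum S) gauss_sector"
    using abs_summable_gauss_sector[OF assms] unfolding summable_on_def by blast
  hence "((\<lambda>w. 1 / norm w ^ s) has_sum (4 * S)) (gauss_int - {0})"
    by (rule has_sum_gauss_int) (simp add: norm_mult)
  thus ?thesis
    by (rule has_sum_imp_summable)
qed

definition gauss_eisenstein :: "nat \<Rightarrow> complex" where
  "gauss_eisenstein s = (\<Sum>\<^sub>\<infinity>w\<in>gauss_int - {0}. 1 / w ^ s)"

text \<open>Conjugation permutes the nonzero Gaussian integers. Reindexing and
  \<open>infsum_cnj\<close> apply whether or not the sum converges, so s is arbitrary.\<close>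

lemma gauss_eisenstein_real: "Im (gauss_eisenstein s) = 0"
proof -
  have "gauss_eisenstein s = (\<Sum>\<^sub>\<infinity>w\<in>gauss_int - {0}. 1 / cnj w ^ s)"
    unfolding gauss_eisenstein_def
    by (rule infsum_reindex_bij_witness[of _ cnj cnj]) (auto simp: gauss_int_def)
  also have "\<dots> = (\<Sum>\<^sub>\<infinity>w\<in>gauss_int - {0}. cnj (1 / w ^ s))"
    by simp
  also have "\<dots> = cnj (gauss_eisenstein s)"
    unfolding gauss_eisenstein_def by (rule infsum_cnj)
  finally show ?thesis
    by (simp add: complex_eq_iff)
qed

text \<open>For 4 | s the summand is invariant under i, so the sector carries a quarter of the sum;
  absolute convergence permits summing it column by column.\<close>

lemma sums_gauss_eisenstein:
  assumes "4 dvd s" "s > 0"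
  shows "(\<lambda>k. \<Sum>b\<in>{- int k<..int k}. Re (1 / Complex (real k) (of_int b) ^ s)) sums
    (Re (gauss_eisenstein s) / 4)"
proof -
  have "s \<ge> 3"
    using assms by (auto simp: dvd_def)
  hence "(\<lambda>w. norm (1 / w ^ s :: complex)) summable_on gauss_sector"
    using abs_summable_gauss_sector[of s] by (simp add: norm_divide norm_power)
  hence "(\<lambda>w. 1 / w ^ s :: complex) summable_on gauss_sector"
    by (rule abs_summable_summable)
  then obtain S where S: "((\<lambda>w. 1 / w ^ s) has_sum S) gauss_sector"
    unfolding summable_on_def by blast
  have "\<i> ^ s = 1"
    using assms(1) by (auto simp: power_mult)
  hence "((\<lambda>w. 1 / w ^ s) has_sum (4 * S)) (gauss_int - {0})"
    by (intro has_sum_gauss_int S) (simp add: power_mult_distrib)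
  hence "gauss_eisenstein s = 4 * S"
    unfolding gauss_eisenstein_def by (rule infsumI)
  hence Re_S: "Re (gauss_eisenstein s) / 4 = Re S"
    by simp
  have "((\<lambda>w. Re (1 / w ^ s)) has_sum Re S) gauss_sector"
    by (rule has_sum_Re[OF S])
  hence "((\<lambda>(k, b). Re (1 / Complex (real k) (of_int b) ^ s)) has_sum Re S) (SIGMA k:UNIV. {- int k<..int k})"
    unfolding has_sum_gauss_sector_iff .
  hence "((\<lambda>k. \<Sum>b\<in>{- int k<..int k}. Re (1 / Complex (real k) (of_int b) ^ s)) has_sum Re S) UNIV"
    by (rule has_sum_SigmaD) (auto intro!: has_sum_finiteI)
  thus ?thesis
    unfolding Re_S by (rule has_sum_imp_sums)
qed

subsection \<open>The Taylor expansion of the regular part\<close>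

lemma omega_t_pos: "omega_t > 0"
  unfolding omega_t_def by (intro divide_pos_pos mult_pos_pos Gamma_real_pos) auto

lemma lattice_eq: "lattice = (\<lambda>w. of_real omega_t * w) ` gauss_int"
proof (intro equalityI subsetI)
  fix w assume "w \<in> lattice"
  then obtain a b where "w = of_int a * of_real omega_t + of_int b * of_real omega_t * \<i>"
    by (auto simp: lattice_def)
  thus "w \<in> (\<lambda>w. of_real omega_t * w) ` gauss_int"
    by (intro image_eqI[of _ _ "Complex (of_int a) (of_int b)"]) (auto simp: gauss_int_def complex_eq_iff)
next
  fix w assume "w \<in> (\<lambda>w. of_real omega_t * w) ` gauss_int"
  then obtain a b where "w = of_real omega_t * Complex (of_int a) (of_int b)"
    by (auto simp: gauss_int_def Ints_def) (metis complex_surj)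
  thus "w \<in> lattice"
    by (auto simp: lattice_def complex_eq_iff intro!: exI[of _ a] exI[of _ b])
qed

lemma has_sum_lattice_iff:
  "(f has_sum S) (lattice - {0}) \<longleftrightarrow> ((\<lambda>w. f (of_real omega_t * w)) has_sum S) (gauss_int - {0})"
proof -
  have "lattice - {0} = (\<lambda>w. of_real omega_t * w) ` (gauss_int - {0})"
    using omega_t_pos by (auto simp: lattice_eq)
  moreover have "inj_on (\<lambda>w. of_real omega_t * w) (gauss_int - {0})"
    using omega_t_pos by (auto simp: inj_on_def)
  ultimately show ?thesis
    by (simp add: has_sum_reindex o_def)
qed

text \<open>Provides one disc around 0 on which all summands of \<open>wp_reg\<close> can be
  expanded simultaneously.\<close>

lemma norm_lattice_ge:
  assumes "w \<in> lattice - {0}"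
  shows "omega_t \<le> norm w"
proof -
  obtain z where z: "w = of_real omega_t * z" "z \<in> gauss_int" "z \<noteq> 0"
    using assms by (auto simp: lattice_eq)
  obtain a b where ab: "Re z = of_int a" "Im z = of_int b"
    using z(2) by (auto simp: gauss_int_def Ints_def)
  have "a \<noteq> 0 \<or> b \<noteq> 0"
    using z(3) ab by (auto simp: complex_eq_iff)
  hence "1 \<le> \<bar>of_int a :: real\<bar> \<or> 1 \<le> \<bar>of_int b :: real\<bar>"
    by linarith
  hence "1 \<le> norm z"
    using abs_Re_le_cmod[of z] abs_Im_le_cmod[of z] ab by linarith
  thus ?thesis
    using z(1) omega_t_pos by (simp add: norm_mult)
qed

lemma abs_summable_lattice:
  assumes "s \<ge> 3"
  shows "(\<lambda>w. 1 / norm w ^ s) summable_on (lattice - {0})"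
proof -
  have "(\<lambda>w. (1 / omega_t ^ s) * (1 / norm w ^ s)) summable_on (gauss_int - {0})"
    by (intro summable_on_cmult_right abs_summable_gauss_int assms)
  thus ?thesis
    using omega_t_pos unfolding summable_on_def has_sum_lattice_iff
    by (simp add: norm_mult power_mult_distrib)
qed

lemma has_sum_lattice_eisenstein:
  assumes "s \<ge> 3"
  shows "((\<lambda>w. 1 / w ^ s) has_sum (gauss_eisenstein s / of_real omega_t ^ s)) (lattice - {0})"
proof -
  have "(\<lambda>w. norm (1 / w ^ s :: complex)) summable_on (gauss_int - {0})"
    using abs_summable_gauss_int[OF assms] by (simp add: norm_divide norm_power)
  hence "(\<lambda>w. 1 / w ^ s :: complex) summable_on (gauss_int - {0})"
    by (rule abs_summable_summable)
  hence "((\<lambda>w. 1 / w ^ s) has_sum gauss_eisenstein s) (gauss_int - {0})"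
    unfolding gauss_eisenstein_def by (rule has_sum_infsum)
  from has_sum_cmult_right[OF this, of "1 / of_real omega_t ^ s"] show ?thesis
    unfolding has_sum_lattice_iff by (simp add: power_mult_distrib)
qed

text \<open>This is the differentiated geometric series in u/w; subtracting 1/w^2 cancels exactly
  its j = 0 term.\<close>

lemma has_sum_wp_summand:
  fixes u w :: complex
  assumes "norm u < norm w"
  shows "((\<lambda>j. (if j = 0 then 0 else of_nat (Suc j)) * u ^ j / w ^ (j + 2)) has_sum
           (1 / (u - w) ^ 2 - 1 / w ^ 2)) UNIV"
proof (rule norm_summable_imp_has_sum)
  have w: "w \<noteq> 0" "w - u \<noteq> 0"
    using assms by auto
  have z: "norm (u / w) < 1"
    using assms w by (simp add: norm_divide)
  have eq: "(\<lambda>j. (if j = 0 then 0 else of_nat (Suc j)) * u ^ j / w ^ (j + 2)) =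
      (\<lambda>j. (of_nat (Suc j) * (u / w) ^ j - (if j = 0 then 1 else 0)) / w ^ 2)"
    using w by (auto simp: fun_eq_iff field_simps power2_eq_square)
  have "(\<lambda>j. (of_nat (Suc j) * (u / w) ^ j - (if j = 0 then 1 else 0)) / w ^ 2)
      sums ((1 / (1 - u / w) ^ 2 - 1) / w ^ 2)"
    by (intro sums_divide sums_diff geometric_deriv_sums z sums_single[of 0 "\<lambda>_. 1"])
  also have "1 / (1 - u / w) ^ 2 = w ^ 2 / (u - w) ^ 2"
    using w by (simp add: field_simps power2_commute[of u w])
  also have "(w ^ 2 / (u - w) ^ 2 - 1) / w ^ 2 = 1 / (u - w) ^ 2 - 1 / w ^ 2"
    using w by (simp add: field_simps)
  finally show "(\<lambda>j. (if j = 0 then 0 else of_nat (Suc j)) * u ^ j / w ^ (j + 2)) sums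
      (1 / (u - w) ^ 2 - 1 / w ^ 2)"
    unfolding eq .
  have "(\<lambda>j. real (Suc j) * norm (u / w) ^ j / norm w ^ 2) sums (1 / (1 - norm (u / w)) ^ 2 / norm w ^ 2)"
    using z by (intro sums_divide geometric_deriv_sums) auto
  hence "summable (\<lambda>j. real (Suc j) * norm (u / w) ^ j / norm w ^ 2)"
    by (simp add: sums_iff)
  thus "summable (\<lambda>j. norm ((if j = 0 then 0 else of_nat (Suc j)) * u ^ j / w ^ (j + 2)))"
    by (rule summable_comparison_test'[where N = 0])
       (auto simp: norm_mult norm_divide norm_power power_divide power2_eq_square mult_ac simp del: of_nat_Suc)
qed

lemma summable_wp_double_series:
  fixes u :: complex
  assumes "norm u \<le> omega_t / 2"
  shows "(\<lambda>(w, j). (if j = 0 then 0 else of_nat (Suc j)) * u ^ j / w ^ (j + 2))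
    summable_on ((lattice - {0}) \<times> UNIV)"
proof -
  let ?f = "\<lambda>(w, j). (if j = 0 then 0 else of_nat (Suc j)) * u ^ j / w ^ (j + 2)"
  \<comment> \<open>A product majorant. Since the j = 0 term is absent, one factor |u| <=
    \<open>omega_t\<close>/2 can be traded for a third power of 1/|w|, which is summable over the
    lattice; halving the radius leaves the factor (1/2)^j.\<close>
  let ?g = "\<lambda>(w, j). (1 / norm w ^ 3) * (omega_t * (real (Suc j) * (1 / 2) ^ j))"
  have "(\<lambda>j. real (Suc j) * (1 / 2) ^ j) sums (1 / (1 - 1 / 2) ^ 2)"
    by (rule geometric_deriv_sums) auto
  hence "summable (\<lambda>j. real (Suc j) * (1 / 2) ^ j)"
    by (simp add: sums_iff)
  hence 1: "(\<lambda>j. real (Suc j) * (1 / 2) ^ j) summable_on UNIV"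
    by (rule summable_nonneg_imp_summable_on) auto
  have "?g summable_on ((lattice - {0}) \<times> UNIV)"
  proof (rule summable_on_SigmaI)
    fix w :: complex
    show "((\<lambda>j. ?g (w, j)) has_sum (1 / norm w ^ 3) * (omega_t * (\<Sum>\<^sub>\<infinity>j. real (Suc j) * (1 / 2) ^ j))) UNIV"
      using 1 by (simp only: prod.case) (intro has_sum_cmult_right has_sum_infsum)
    show "(\<lambda>w. (1 / norm w ^ 3) * (omega_t * (\<Sum>\<^sub>\<infinity>j. real (Suc j) * (1 / 2) ^ j)))
        summable_on (lattice - {0})"
      by (intro summable_on_cmult_left abs_summable_lattice) auto
    show "0 \<le> ?g (w, j)" for j
      using omega_t_pos by auto
  qed
  hence "(\<lambda>x. norm (?f x)) summable_on ((lattice - {0}) \<times> UNIV)"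
  proof (rule Infinite_Sum.abs_summable_on_comparison_test')
    fix x assume x: "x \<in> (lattice - {0}) \<times> (UNIV :: nat set)"
    obtain w j where wj: "x = (w, j)" by (cases x)
    have w: "w \<in> lattice - {0}" and w0: "w \<noteq> 0"
      using x wj by auto
    show "norm (?f x) \<le> ?g x"
    proof (cases j)
      case 0
      thus ?thesis
        using wj omega_t_pos by simp
    next
      case (Suc i)
      have "norm u ^ j \<le> (omega_t / 2) ^ j"
        using assms by (intro power_mono) auto
      also have "\<dots> = (omega_t * (1 / 2) ^ j) * omega_t ^ i"
        by (simp add: Suc power_divide)
      also have "\<dots> \<le> (omega_t * (1 / 2) ^ j) * norm w ^ i"
        using omega_t_pos norm_lattice_ge[OF w] by (intro mult_left_mono power_mono) auto
      finally have "norm u ^ j \<le> omega_t * (1 / 2) ^ j * norm w ^ i" .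
      hence "norm u ^ j / norm w ^ (j + 2) \<le> omega_t * (1 / 2) ^ j * norm w ^ i / norm w ^ (j + 2)"
        by (intro divide_right_mono) auto
      also have "\<dots> = omega_t * (1 / 2) ^ j / norm w ^ 3"
        using w0 by (simp add: Suc power_add eval_nat_numeral)
      finally have "real (Suc j) * (norm u ^ j / norm w ^ (j + 2)) \<le> real (Suc j) * (omega_t * (1 / 2) ^ j / norm w ^ 3)"
        by (intro mult_left_mono) auto
      thus ?thesis
        using Suc by (simp add: wj norm_mult norm_divide norm_power mult_ac del: of_nat_Suc)
    qed
  qed
  thus ?thesis
    by (rule abs_summable_summable)
qed

text \<open>The absolutely convergent double series is summed in both orders: over j first it gives
  \<open>wp_reg u\<close>, over the lattice first it gives Eisenstein sums as coefficients.\<close>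

lemma wp_reg_has_fps_expansion:
  "wp_reg has_fps_expansion
     Abs_fps (\<lambda>j. if j = 0 then 0 else of_nat (Suc j) * (gauss_eisenstein (j + 2) / of_real omega_t ^ (j + 2)))"
  (is "_ has_fps_expansion ?F")
proof (rule has_fps_expansionI)
  have "eventually (\<lambda>u. u \<in> ball 0 (omega_t / 2)) (nhds (0::complex))"
    using omega_t_pos by (intro eventually_nhds_in_open) auto
  thus "eventually (\<lambda>u. (\<lambda>j. fps_nth ?F j * u ^ j) sums wp_reg u) (nhds 0)"
  proof eventually_elim
    case (elim u)
    let ?f = "\<lambda>(w, j). (if j = 0 then 0 else of_nat (Suc j)) * u ^ j / w ^ (j + 2)"
    from elim have u: "norm u \<le> omega_t / 2" "norm u < omega_t"
      using omega_t_pos by auto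
    obtain S where S: "(?f has_sum S) ((lattice - {0}) \<times> UNIV)"
      using summable_wp_double_series[OF u(1)] unfolding summable_on_def by blast
    have "((\<lambda>w. 1 / (u - w) ^ 2 - 1 / w ^ 2) has_sum S) (lattice - {0})"
      using S
    proof (rule has_sum_SigmaD)
      fix w assume "w \<in> lattice - {0}"
      hence "norm u < norm w"
        using norm_lattice_ge[of w] u by auto
      thus "((\<lambda>j. ?f (w, j)) has_sum (1 / (u - w) ^ 2 - 1 / w ^ 2)) UNIV"
        using has_sum_wp_summand by simp
    qed
    hence wp: "wp_reg u = S"
      unfolding wp_reg_def by (rule infsumI)
    have "((\<lambda>(j, w). ?f (w, j)) has_sum S) (UNIV \<times> (lattice - {0}))"
      using S by (subst (asm) has_sum_swap)
    hence "((\<lambda>j. fps_nth ?F j * u ^ j) has_sum S) UNIV"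
    proof (rule has_sum_SigmaD)
      fix j :: nat
      show "((\<lambda>w. (\<lambda>(j, w). ?f (w, j)) (j, w)) has_sum (fps_nth ?F j * u ^ j)) (lattice - {0})"
      proof (cases "j = 0")
        case False
        from has_sum_cmult_right[OF has_sum_lattice_eisenstein[of "j + 2"], of "of_nat (Suc j) * u ^ j"] False
        show ?thesis
          by (simp add: mult_ac del: of_nat_Suc power_Suc)
      qed simp
    qed
    thus ?case
      unfolding wp by (rule has_sum_imp_sums)
  qed
qed

text \<open>Taylor coefficients are compared at j = n - 2, where (j+1) j! = (n-1)!. For n >= 3 this
  avoids the constant term, which was set to 0.\<close>

lemma hurwitz_eq_gauss_eisenstein:
  assumes "n \<ge> 3"
  shows "hurwitz n = of_nat n / 2 ^ n * (fact (n - 1) * gauss_eisenstein n / of_real omega_t ^ n)"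
proof -
  obtain j where n: "n = j + 2" "j > 0"
    using assms by (intro that[of "n - 2"]) auto
  have "of_nat (Suc j) * (gauss_eisenstein n / of_real omega_t ^ n) = (deriv ^^ j) wp_reg 0 / fact j"
    using fps_nth_fps_expansion[OF wp_reg_has_fps_expansion, of j] n by simp
  hence "(deriv ^^ j) wp_reg 0 = fact (Suc j) * gauss_eisenstein n / of_real omega_t ^ n"
    by (simp add: field_simps)
  thus ?thesis
    by (simp add: hurwitz_def n)
qed

subsection \<open>The recurrence\<close>

text \<open>The same column series is evaluated twice. The 8 is the 2 from the generating function
  times the 4 rotations.\<close>

lemma LBINT_power_f1:
  assumes "k \<ge> 1"
  shows "(LBINT t:{0<..}. t ^ (4 * k - 1) * (exp (- t) * f1 t)) =
    fact (4 * k - 1) * Re (gauss_eisenstein (4 * k)) / 8"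
proof -
  have "(\<lambda>j. \<Sum>b\<in>{- int j<..int j}. Re (1 / Complex (real j) (of_int b) ^ (4 * k))) sums
      (2 / fact (4 * k - 1) * (LBINT t:{0<..}. t ^ (4 * k - 1) * (exp (- t) * f1 t)))"
    using sums_LBINT_power_f1[of "4 * k - 1"] assms by simp
  moreover have "(\<lambda>j. \<Sum>b\<in>{- int j<..int j}. Re (1 / Complex (real j) (of_int b) ^ (4 * k))) sums
      (Re (gauss_eisenstein (4 * k)) / 4)"
    using assms by (intro sums_gauss_eisenstein) auto
  ultimately have "2 / fact (4 * k - 1) * (LBINT t:{0<..}. t ^ (4 * k - 1) * (exp (- t) * f1 t)) =
      Re (gauss_eisenstein (4 * k)) / 4"
    by (rule sums_unique2)
  thus ?thesis
    by (simp add: field_simps)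
qed

lemma C_H_eq_sum:
  "C_H n = (\<Sum>k=1..n. real ((4 * n) choose (4 * k)) *
     (fact (4 * k - 1) * Re (gauss_eisenstein (4 * k)) / (8 * omega_t ^ (4 * k))))"
proof -
  define c where "c = (\<lambda>k. real ((4 * n) choose (4 * k)) / omega_t ^ (4 * k))"
  have integrand: "1 / t * exp (- t) * f1 t *
      (- 1 + hyp4F3 (1/4 - real n) (1/2 - real n) (3/4 - real n) (- real n) (1/4) (1/2) (3/4)
        (t ^ 4 / omega_t ^ 4)) =
      (\<Sum>k=1..n. c k * (t ^ (4 * k - 1) * (exp (- t) * f1 t)))" if "t > 0" for t
  proof -
    \<comment> \<open>The index 0 is split off because its term is 1 and cancels the -1; every other
      power of t absorbs the factor 1/t.\<close>
    have "hyp4F3 (1/4 - real n) (1/2 - real n) (3/4 - real n) (- real n) (1/4) (1/2) (3/4)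
        (t ^ 4 / omega_t ^ 4) = (\<Sum>k\<in>insert 0 {1..n}. c k * t ^ (4 * k))"
      unfolding hyp4F3_eq_sum_binomial
      by (intro sum.cong) (auto simp: c_def power_divide power_mult)
    also have "\<dots> = 1 + (\<Sum>k=1..n. c k * t ^ (4 * k))"
      by (simp add: c_def)
    finally have "1 / t * exp (- t) * f1 t *
        (- 1 + hyp4F3 (1/4 - real n) (1/2 - real n) (3/4 - real n) (- real n) (1/4) (1/2) (3/4)
          (t ^ 4 / omega_t ^ 4)) =
        (\<Sum>k=1..n. 1 / t * exp (- t) * f1 t * (c k * t ^ (4 * k)))"
      by (simp add: sum_distrib_left)
    also have "\<dots> = (\<Sum>k=1..n. c k * (t ^ (4 * k - 1) * (exp (- t) * f1 t)))"
    proof (intro sum.cong refl)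
      fix k assume "k \<in> {1..n}"
      hence "t ^ (4 * k) = t * t ^ (4 * k - 1)"
        by (simp flip: power_Suc)
      thus "1 / t * exp (- t) * f1 t * (c k * t ^ (4 * k)) = c k * (t ^ (4 * k - 1) * (exp (- t) * f1 t))"
        using that by simp
    qed
    finally show ?thesis .
  qed
  have int: "set_integrable lborel {0<..} (\<lambda>t. c k * (t ^ (4 * k - 1) * (exp (- t) * f1 t)))"
    if "k \<in> {1..n}" for k
    using that by (intro set_integrable_mult_right set_integrable_power_f1) auto
  have "C_H n = (LBINT t:{0<..}. \<Sum>k=1..n. c k * (t ^ (4 * k - 1) * (exp (- t) * f1 t)))"
    unfolding C_H_def by (intro set_lebesgue_integral_cong) (use integrand in auto)
  also have "\<dots> = (\<Sum>k=1..n. LBINT t:{0<..}. c k * (t ^ (4 * k - 1) * (exp (- t) * f1 t)))"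
    using int unfolding set_lebesgue_integral_def set_integrable_def scaleR_sum_right
    by (intro Bochner_Integration.integral_sum)
  also have "\<dots> = (\<Sum>k=1..n. c k * (fact (4 * k - 1) * Re (gauss_eisenstein (4 * k)) / 8))"
  proof (intro sum.cong refl)
    fix k assume "k \<in> {1..n}"
    thus "(LBINT t:{0<..}. c k * (t ^ (4 * k - 1) * (exp (- t) * f1 t))) =
        c k * (fact (4 * k - 1) * Re (gauss_eisenstein (4 * k)) / 8)"
      using LBINT_power_f1[of k] by (subst set_integral_mult_right) simp
  qed
  finally show ?thesis
    by (simp add: c_def mult.commute)
qed

text \<open>The prefactor is matched to the normalisation 4k / 2^(4k) of the Hurwitz numbers: as
  2^(4k) = 4 * 4^(2k-1), their product is 1/8, the constant of
  \<open>LBINT_power_f1\<close>.\<close>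

lemma hurwitz_quadruple:
  assumes "k \<ge> 1"
  shows "4 ^ (2 * k - 1) / (8 * of_nat k) * hurwitz (4 * k) =
    complex_of_real (fact (4 * k - 1) * Re (gauss_eisenstein (4 * k)) / (8 * omega_t ^ (4 * k)))"
proof -
  have G: "gauss_eisenstein (4 * k) = of_real (Re (gauss_eisenstein (4 * k)))"
    by (simp add: complex_eq_iff gauss_eisenstein_real)
  have "(2::complex) ^ (4 * k) = 4 ^ (2 * k)"
    using power_mult[of "2::complex" 2 "2 * k"] by simp
  also have "\<dots> = 4 * 4 ^ (2 * k - 1)"
    using assms by (simp flip: power_Suc)
  finally have "hurwitz (4 * k) = of_nat (4 * k) / (4 * 4 ^ (2 * k - 1)) *
      (fact (4 * k - 1) * gauss_eisenstein (4 * k) / of_real omega_t ^ (4 * k))"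
    using assms by (simp add: hurwitz_eq_gauss_eisenstein)
  hence "4 ^ (2 * k - 1) / (8 * of_nat k) * hurwitz (4 * k) =
      fact (4 * k - 1) * gauss_eisenstein (4 * k) / (8 * of_real omega_t ^ (4 * k))"
    using assms by simp
  thus ?thesis
    by (subst (asm) G) simp
qed

theorem theorem15:
  fixes n :: nat
  assumes "n \<ge> 1"
  shows "4 ^ (2*n - 1) / (8 * of_nat n) * hurwitz (4*n)
    = complex_of_real (C_H n)
      - (\<Sum>k=1..n-1. of_nat ((4*n) choose (4*k)) * 4 ^ (2*k - 1) / (8 * of_nat k) * hurwitz (4*k))"
proof -
  let ?T = "\<lambda>k. fact (4 * k - 1) * Re (gauss_eisenstein (4 * k)) / (8 * omega_t ^ (4 * k))"
  have "(\<Sum>k=1..n-1. of_nat ((4*n) choose (4*k)) * 4 ^ (2*k - 1) / (8 * of_nat k) * hurwitz (4*k)) =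
      (\<Sum>k=1..n-1. complex_of_real (real ((4*n) choose (4*k)) * ?T k))"
  proof (intro sum.cong refl)
    fix k assume "k \<in> {1..n-1}"
    hence "of_nat ((4*n) choose (4*k)) * (4 ^ (2*k - 1) / (8 * of_nat k) * hurwitz (4*k)) =
        of_nat ((4*n) choose (4*k)) * complex_of_real (?T k)"
      by (subst hurwitz_quadruple) auto
    thus "of_nat ((4*n) choose (4*k)) * 4 ^ (2*k - 1) / (8 * of_nat k) * hurwitz (4*k) =
        complex_of_real (real ((4*n) choose (4*k)) * ?T k)"
      by (simp add: mult.assoc)
  qed
  \<comment> \<open>The top summand has binomial coefficient 1, so it is precisely the left-hand
    side of the theorem.\<close>
  moreover have "{1..n} = insert n {1..n-1}"
    using assms by auto
  hence "complex_of_real (C_H n) = complex_of_real (?T n) +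
      (\<Sum>k=1..n-1. complex_of_real (real ((4*n) choose (4*k)) * ?T k))"
    using assms by (simp add: C_H_eq_sum)
  ultimately show ?thesis
    using hurwitz_quadruple[OF assms] by simp
qed

end
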